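(* Let $m$ and $r$ be positive integers, and let $\mathbf{v}$ be an admissible vector (with respect to the Lee norm $\|\cdot\|_2$) in $V=(\mathbb{Z}/m\mathbb{Z})^r$ whose Lee norm $\|\mathbf{v}\|_2$ is maximal among all admissible vectors in $V$. Then $\|\mathbf{v}\|_2=h(m,r)$, where $$h(m,r)=\begin{cases}\frac{mr}{4} & \text{if $m$ and $r$ are even};\\ \lfloor\frac{mr}{4}-\frac12\rfloor & \text{if $m$ is even, $r$ is odd, and $r>m$};\\ \lfloor\frac{mr}{4}-\frac{r}{4m}\rfloor & \text{if $m$ is odd and $r>m$};\\ \lfloor\frac{mr}{4}-\frac12\rfloor & \text{if $m$ is odd, $r$ is even, and $r<m$};\\ \lfloor\frac{mr}{4}-\frac{m}{4r}\rfloor & \text{if $r$ is odd and $r\le m$}.\end{cases}$$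
   Context: For $x\in\mathbb{Z}/m\mathbb{Z}$ let $\bar{x}\in\{0,1,\ldots,m-1\}$ be its least nonnegative residue and $|x|=\min\{\bar{x},m-\bar{x}\}$. The Lee norm of $\mathbf{v}=(v_1,\ldots,v_r)\in(\mathbb{Z}/m\mathbb{Z})^r$ is $\|\mathbf{v}\|_2=\sum_{i=1}^r|v_i|$ (an integer). Let $\mathbf{e}=(1,1,\ldots,1)\in(\mathbb{Z}/m\mathbb{Z})^r$. A vector $\mathbf{v}$ is called admissible (with respect to $\|\cdot\|_2$) if $\|\mathbf{v}\|_2\le\|\mathbf{v}+x\mathbf{e}\|_2$ for all $x\in\mathbb{Z}/m\mathbb{Z}$. *)

theory Defs
  imports Complex_Main "HOL-Number_Theory.Residues"
begin

text \<open>
  Elements of \<open>\<int>/m\<int>\<close> are those of the library ring \<^term>\<open>residue_ring (int m)\<close>, whose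
  carrier is \<open>{0, \<dots>, m - 1}\<close>.  For \<open>m = 1\<close> its \<^const>\<open>one\<close> field is the integer \<open>1\<close>, outside
  the carrier \<open>{0}\<close>; the unit is therefore written \<open>1 mod m\<close> below.
\<close>

definition vectors :: "nat \<Rightarrow> nat \<Rightarrow> (nat \<Rightarrow> int) set" where
  "vectors m r = {1..r} \<rightarrow>\<^sub>E carrier (residue_ring (int m))"

definition vec_add :: "nat \<Rightarrow> nat \<Rightarrow> (nat \<Rightarrow> int) \<Rightarrow> (nat \<Rightarrow> int) \<Rightarrow> nat \<Rightarrow> int" where
  "vec_add m r v w = (\<lambda>i\<in>{1..r}. v i \<oplus>\<^bsub>residue_ring (int m)\<^esub> w i)"

definition vec_scale :: "nat \<Rightarrow> nat \<Rightarrow> int \<Rightarrow> (nat \<Rightarrow> int) \<Rightarrow> nat \<Rightarrow> int" where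
  "vec_scale m r x v = (\<lambda>i\<in>{1..r}. x \<otimes>\<^bsub>residue_ring (int m)\<^esub> v i)"

definition all_ones :: "nat \<Rightarrow> nat \<Rightarrow> nat \<Rightarrow> int" where
  "all_ones m r = (\<lambda>i\<in>{1..r}. 1 mod int m)"

definition lee_abs :: "nat \<Rightarrow> int \<Rightarrow> int" where
  "lee_abs m x = min (x mod int m) (int m - x mod int m)"

definition lee_norm :: "nat \<Rightarrow> nat \<Rightarrow> (nat \<Rightarrow> int) \<Rightarrow> int" where
  "lee_norm m r v = (\<Sum>i=1..r. lee_abs m (v i))"

definition admissible :: "nat \<Rightarrow> nat \<Rightarrow> (nat \<Rightarrow> int) \<Rightarrow> bool" where
  "admissible m r v \<longleftrightarrow> v \<in> vectors m r \<and>
     (\<forall>x \<in> carrier (residue_ring (int m)).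
        lee_norm m r v \<le> lee_norm m r (vec_add m r v (vec_scale m r x (all_ones m r))))"

text \<open>
  The value is real so that \<open>mr/4\<close> is true division.  For positive \<open>m\<close> and \<open>r\<close> the five
  conditions are exhaustive and mutually exclusive, so \<^const>\<open>undefined\<close> is never reached.
\<close>

definition h :: "nat \<Rightarrow> nat \<Rightarrow> real" where
  "h m r =
    (if even m \<and> even r then real m * real r / 4
     else if even m \<and> odd r \<and> r > m then of_int \<lfloor>real m * real r / 4 - 1 / 2\<rfloor>
     else if odd m \<and> r > m then of_int \<lfloor>real m * real r / 4 - real r / (4 * real m)\<rfloor>
     else if odd m \<and> even r \<and> r < m then of_int \<lfloor>real m * real r / 4 - 1 / 2\<rfloor>
     else if odd r \<and> r \<le> m then of_int \<lfloor>real m * real r / 4 - real m / (4 * real r)\<rfloor>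
     else undefined)"

end

(* Write S(x) for the norm of v + x e.  An admissible norm is at most any average of the S(x):
   over all x, over an antipodal pair, or, for odd r, over x = - v_i, where a half circle and its
   complement split the r points unevenly.  Conversely, an integer that is a lower bound of S for
   some v is a lower bound of the maximum.  Even r: put the points in pairs spanning arcs of length
   floor(m/2) laid end to end.  Odd r > m with m odd: add one copy of the whole circle.  Odd r
   otherwise: spread r points evenly over a half circle and replace every other one by its
   antipode. *)
theory Submission
  imports Defs
begin

section \<open>Norms of translated points and distances on a circle\<close>

definition shift_norm :: "nat \<Rightarrow> nat \<Rightarrow> (nat \<Rightarrow> int) \<Rightarrow> int \<Rightarrow> int" where
  "shift_norm m r f x = (\<Sum>j<r. lee_abs m (f j + x))"

text \<open>Minimality of a particular shift is left out on purpose: constructions may use any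
  integer coordinates, and \<open>attainable_imp_admissible\<close> picks the best shift
  afterwards.\<close>

definition attainable :: "nat \<Rightarrow> nat \<Rightarrow> int \<Rightarrow> bool" where
  "attainable m r B \<longleftrightarrow> (\<exists>f. \<forall>x. B \<le> shift_norm m r f x)"

lemma attainableI: "(\<And>x. B \<le> shift_norm m r f x) \<Longrightarrow> attainable m r B"
  unfolding attainable_def by blast

lemma lee_abs_cong: "x mod int m = y mod int m \<Longrightarrow> lee_abs m x = lee_abs m y"
  by (simp add: lee_abs_def)

lemma lee_abs_of_abs_le:
  assumes "m > 0" "2 * \<bar>z\<bar> \<le> int m"
  shows "lee_abs m z = \<bar>z\<bar>"
proof (cases "z \<ge> 0")
  case True
  then have "z mod int m = z" using assms by (intro mod_pos_pos_trivial) auto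
  then show ?thesis using assms True by (simp add: lee_abs_def)
next
  case False
  then have "(z + int m) mod int m = z + int m" using assms by (intro mod_pos_pos_trivial) auto
  then have "z mod int m = z + int m" by simp
  then show ?thesis using assms False by (simp add: lee_abs_def)
qed

text \<open>Doubling embeds \<int>/m into \<int>/2m, where every point has an antipode even if
  \<open>m\<close> is odd.\<close>

lemma lee_abs_double: "lee_abs (2 * m) (2 * y) = 2 * lee_abs m y"
  by (simp add: lee_abs_def mod_mult_mult1 min_def)

lemma mod_int_unique:
  fixes x q t :: int
  assumes "x = m * q + t" "0 \<le> t" "t < m"
  shows "x mod m = t" "x div m = q"
  using assms by (auto simp: mod_pos_pos_trivial div_pos_pos_trivial)

text \<open>A point and its antipode cut the circle into two arcs of length \<open>a\<close>, and
  \<open>0\<close> lies on one of them.\<close>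

lemma lee_abs_antipode:
  assumes "a > 0"
  shows "lee_abs (2 * a) (y + int a) = int a - lee_abs (2 * a) y"
proof -
  define t where "t = y mod (2 * int a)"
  define q where "q = y div (2 * int a)"
  have y: "y = 2 * int a * q + t" and t: "0 \<le> t" "t < 2 * int a"
    using assms by (simp_all add: t_def q_def)
  show ?thesis
  proof (cases "t < int a")
    case True
    have "(y + int a) mod (2 * int a) = t + int a"
      by (rule mod_int_unique(1)[of _ _ q]) (use y t True in auto)
    then show ?thesis using True t by (simp add: lee_abs_def t_def[symmetric] min_def)
  next
    case False
    have "(y + int a) mod (2 * int a) = t - int a"
      by (rule mod_int_unique(1)[of _ _ "q + 1"]) (use y t False in \<open>auto simp: algebra_simps\<close>)
    then show ?thesis using False t by (simp add: lee_abs_def t_def[symmetric] min_def)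
  qed
qed

lemma sum_periodic_shift:
  fixes f :: "int \<Rightarrow> int"
  assumes "M > 0" "\<And>x. f (x + M) = f x"
  shows "(\<Sum>x\<in>{0..<M}. f (c + x)) = (\<Sum>x\<in>{0..<M}. f x)"
proof -
  \<comment> \<open>Moving the window by one exchanges \<open>f d\<close> for
    \<open>f (d + M)\<close>, which are equal.\<close>
  have step: "(\<Sum>x\<in>{0..<M}. f (d + 1 + x)) = (\<Sum>x\<in>{0..<M}. f (d + x))" for d
  proof -
    have "(\<Sum>x\<in>{0..<M}. f (d + 1 + x)) = (\<Sum>x\<in>{1..<M+1}. f (d + x))"
      by (rule sum.reindex_bij_witness[of _ "\<lambda>x. x - 1" "\<lambda>x. x + 1"]) (auto simp: algebra_simps)
    also have "{1..<M+1} = insert M {1..<M}" using assms(1) by auto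
    also have "(\<Sum>x\<in>insert M {1..<M}. f (d + x)) = f (d + M) + (\<Sum>x\<in>{1..<M}. f (d + x))"
      by simp
    also have "\<dots> = (\<Sum>x\<in>insert 0 {1..<M}. f (d + x))" using assms(2) by simp
    also have "insert 0 {1..<M} = {0..<M}" using assms(1) by auto
    finally show ?thesis .
  qed
  show ?thesis
  proof (induction c rule: int_induct[where k = 0])
    case base
    then show ?case by simp
  next
    case (step1 i)
    then show ?case using step[of i] by simp
  next
    case (step2 i)
    then show ?case using step[of "i - 1"] by simp
  qed
qed

section \<open>Admissible vectors\<close>

lemma lee_norm_eq_shift_norm: "lee_norm m r v = shift_norm m r (\<lambda>j. v (Suc j)) 0"
  unfolding lee_norm_def shift_norm_def
  by (rule sum.reindex_bij_witness[of _ Suc "\<lambda>i. i - 1"]) auto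

lemma lee_norm_shift:
  "lee_norm m r (vec_add m r v (vec_scale m r x (all_ones m r))) =
     shift_norm m r (\<lambda>j. v (Suc j)) x"
proof -
  have "lee_abs m (vec_add m r v (vec_scale m r x (all_ones m r)) i) = lee_abs m (v i + x)"
    if "i \<in> {1..r}" for i
    using that
    by (intro lee_abs_cong)
      (simp add: vec_add_def vec_scale_def all_ones_def residue_ring_def mod_simps)
  then have "lee_norm m r (vec_add m r v (vec_scale m r x (all_ones m r))) =
      (\<Sum>i=1..r. lee_abs m (v i + x))"
    unfolding lee_norm_def by (intro sum.cong) auto
  also have "\<dots> = shift_norm m r (\<lambda>j. v (Suc j)) x"
    unfolding shift_norm_def
    by (rule sum.reindex_bij_witness[of _ Suc "\<lambda>i. i - 1"]) auto
  finally show ?thesis .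
qed

lemma shift_norm_mod: "shift_norm m r f (x mod int m) = shift_norm m r f x"
  unfolding shift_norm_def by (intro sum.cong lee_abs_cong) (auto simp: mod_simps)

lemma carrier_residue_ring_eq: "m > 0 \<Longrightarrow> carrier (residue_ring (int m)) = {0..<int m}"
  by (auto simp: residue_ring_def)

lemma admissible_le_shift_norm:
  assumes "m > 0" "admissible m r v"
  shows "lee_norm m r v \<le> shift_norm m r (\<lambda>j. v (Suc j)) x"
proof -
  have "x mod int m \<in> carrier (residue_ring (int m))"
    using assms(1) by (simp add: carrier_residue_ring_eq)
  then have "lee_norm m r v \<le> shift_norm m r (\<lambda>j. v (Suc j)) (x mod int m)"
    using assms(2) unfolding admissible_def lee_norm_shift by blast
  then show ?thesis by (simp add: shift_norm_mod)
qed

text \<open>Translating \<open>f\<close> by a shift \<open>x0\<close> of least norm makes the vector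
  minimal in its own orbit, hence admissible, and its norm is still one of the values bounded by
  \<open>B\<close>.\<close>

lemma attainable_imp_admissible:
  assumes "m > 0" "attainable m r B"
  obtains w where "admissible m r w" "B \<le> lee_norm m r w"
proof -
  obtain f where f: "\<And>x. B \<le> shift_norm m r f x"
    using assms(2) unfolding attainable_def by blast
  obtain x0 where "is_arg_min (shift_norm m r f) (\<lambda>x. x \<in> {0..<int m}) x0"
    using ex_is_arg_min_if_finite[of "{0..<int m}" "shift_norm m r f"] assms(1) by auto
  then have min: "shift_norm m r f x0 \<le> shift_norm m r f x" for x
    using assms(1) shift_norm_mod[of m r f x] unfolding is_arg_min_linorder
    by (metis atLeastLessThan_iff of_nat_0_less_iff pos_mod_bound pos_mod_sign)
  define w where "w = (\<lambda>i\<in>{1..r}. (f (i - 1) + x0) mod int m)"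
  have w: "shift_norm m r (\<lambda>j. w (Suc j)) x = shift_norm m r f (x0 + x)" for x
    unfolding shift_norm_def
    by (intro sum.cong lee_abs_cong) (auto simp: w_def mod_simps algebra_simps)
  have "w \<in> vectors m r"
    using assms(1) by (auto simp: vectors_def carrier_residue_ring_eq w_def)
  moreover have "lee_norm m r w = shift_norm m r f x0"
    using w[of 0] by (simp add: lee_norm_eq_shift_norm)
  ultimately show thesis
    using that[of w] f[of x0] min w unfolding admissible_def lee_norm_shift by simp
qed

section \<open>Upper bounds\<close>

lemma sum_lee_abs_odd:
  "(\<Sum>x\<in>{0..<int (2 * a + 1)}. lee_abs (2 * a + 1) x) = int a * (int a + 1)"
proof -
  have eq: "{0..<int (2 * a + 1)} = {0..int a} \<union> {int a + 1..2 * int a}" by auto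
  have gauss: "2 * (\<Sum>x\<in>{0..int n}. x) = int n * (int n + 1)" for n
  proof (induction n)
    case (Suc n)
    have "{0..int (Suc n)} = insert (int (Suc n)) {0..int n}" by auto
    then show ?case using Suc by (simp add: algebra_simps)
  qed simp
  have "(\<Sum>x\<in>{0..<int (2 * a + 1)}. lee_abs (2 * a + 1) x) =
      (\<Sum>x\<in>{0..int a}. lee_abs (2 * a + 1) x) + (\<Sum>x\<in>{int a + 1..2 * int a}. lee_abs (2 * a + 1) x)"
    unfolding eq by (rule sum.union_disjoint) auto
  also have "(\<Sum>x\<in>{0..int a}. lee_abs (2 * a + 1) x) = (\<Sum>x\<in>{0..int a}. x)"
    by (intro sum.cong) (auto simp: lee_abs_def)
  also have "(\<Sum>x\<in>{int a + 1..2 * int a}. lee_abs (2 * a + 1) x) = (\<Sum>x\<in>{1..int a}. x)"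
    by (rule sum.reindex_bij_witness[of _ "\<lambda>x. 2 * int a + 1 - x" "\<lambda>x. 2 * int a + 1 - x"])
      (auto simp: lee_abs_def)
  also have "(\<Sum>x\<in>{1..int a}. x) = (\<Sum>x\<in>{0..int a}. x)"
    by (rule sum.mono_neutral_left) auto
  finally show ?thesis using gauss[of a] by simp
qed

text \<open>Over all \<open>m\<close> shifts each point visits the whole circle once and contributes
  \<open>a * (a + 1)\<close>, which is \<open>(m^2 - 1) / 4\<close>.\<close>

lemma upper_bound_odd_modulus:
  assumes "odd m" "\<And>x. N \<le> shift_norm m r f x"
  shows "4 * int m * N \<le> int r * ((int m)\<^sup>2 - 1)"
proof -
  obtain a where m: "m = 2 * a + 1" using assms(1) by (auto elim: oddE)
  have "int m * N = (\<Sum>x\<in>{0..<int m}. N)" by simp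
  also have "\<dots> \<le> (\<Sum>x\<in>{0..<int m}. shift_norm m r f x)" by (intro sum_mono assms(2))
  also have "\<dots> = (\<Sum>j<r. \<Sum>x\<in>{0..<int m}. lee_abs m (f j + x))"
    unfolding shift_norm_def by (rule sum.swap)
  also have "\<dots> = (\<Sum>j<r. \<Sum>x\<in>{0..<int m}. lee_abs m x)"
    by (intro sum.cong refl sum_periodic_shift) (auto simp: m lee_abs_def)
  also have "\<dots> = int r * (int a * (int a + 1))"
    using sum_lee_abs_odd[of a] by (simp add: m)
  finally show ?thesis unfolding m by (simp add: power2_eq_square algebra_simps)
qed

section \<open>Even modulus: antipodal shifts and parity\<close>

lemma shift_norm_antipode:
  assumes "a > 0"
  shows "shift_norm (2 * a) r f (x + int a) = int r * int a - shift_norm (2 * a) r f x"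
  using lee_abs_antipode[OF assms, of "f j + x" for j]
  by (simp add: shift_norm_def sum_subtractf add.assoc[symmetric])

text \<open>The norms at two antipodal shifts add up to \<open>r * a\<close>, and each is at least
  \<open>N\<close>.\<close>

lemma upper_bound_even_modulus:
  assumes "a > 0" "\<And>x. N \<le> shift_norm (2 * a) r f x"
  shows "2 * N \<le> int r * int a"
  using assms(2)[of 0] assms(2)[of "int a"] shift_norm_antipode[OF assms(1), of r f 0] by simp

text \<open>With \<open>m\<close> even, both candidates in the minimum have the parity of
  \<open>x\<close>.\<close>

lemma even_lee_abs_iff:
  assumes "even m"
  shows "even (lee_abs m x) \<longleftrightarrow> even x"
proof -
  have "even (x mod int m) \<longleftrightarrow> even x"
    using assms by (simp add: dvd_mod_iff)
  then show ?thesis using assms by (auto simp: lee_abs_def min_def)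
qed

lemma odd_lee_abs_add_Suc:
  assumes "even m"
  shows "odd (lee_abs m x + lee_abs m (x + 1))"
  using even_lee_abs_iff[OF assms] by simp

lemma odd_sum_odd:
  fixes g :: "nat \<Rightarrow> int"
  assumes "odd r" "\<And>j. odd (g j)"
  shows "odd (\<Sum>j<r. g j)"
proof -
  have "odd (\<Sum>j<n. g j) \<longleftrightarrow> odd n" for n
    by (induction n) (use assms(2) in auto)
  then show ?thesis using assms(1) by simp
qed

text \<open>Equality in \<open>2 * N \<le> r * a\<close> would make the norm the same for all shifts, but for odd
  \<open>r\<close> a unit shift changes its parity.\<close>

lemma upper_bound_even_modulus_odd_length:
  assumes "a > 0" "odd r" "\<And>x. N \<le> shift_norm (2 * a) r f x"
  shows "2 * N \<le> int r * int a - 1"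
proof (rule ccontr)
  assume "\<not> ?thesis"
  then have N: "2 * N = int r * int a"
    using upper_bound_even_modulus[OF assms(1,3)] by simp
  have const: "shift_norm (2 * a) r f x = N" for x
    using assms(3)[of x] assms(3)[of "x + int a"] shift_norm_antipode[OF assms(1), of r f x] N
    by linarith
  have "odd (\<Sum>j<r. lee_abs (2 * a) (f j) + lee_abs (2 * a) (f j + 1))"
    by (rule odd_sum_odd[OF assms(2)]) (rule odd_lee_abs_add_Suc, simp)
  then have "odd (shift_norm (2 * a) r f 0 + shift_norm (2 * a) r f 1)"
    by (simp add: shift_norm_def sum.distrib)
  then show False by (simp add: const)
qed

section \<open>Odd length: signs of half circles and their correlation\<close>

definition half_sign :: "nat \<Rightarrow> int \<Rightarrow> int" where
  "half_sign m y = (if y mod (2 * int m) < int m then 1 else -1)"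

lemma half_sign_periodic: "half_sign m (y + 2 * int m) = half_sign m y"
  by (simp add: half_sign_def)

lemma half_sign_antipode:
  assumes "m > 0"
  shows "half_sign m (y + int m) = - half_sign m y"
proof -
  define t where "t = y mod (2 * int m)"
  define q where "q = y div (2 * int m)"
  have y: "y = 2 * int m * q + t" and t: "0 \<le> t" "t < 2 * int m"
    using assms by (simp_all add: t_def q_def)
  show ?thesis
  proof (cases "t < int m")
    case True
    have "(y + int m) mod (2 * int m) = t + int m"
      by (rule mod_int_unique(1)[of _ _ q]) (use y t True in auto)
    then show ?thesis using True t by (simp add: half_sign_def t_def[symmetric])
  next
    case False
    have "(y + int m) mod (2 * int m) = t - int m"
      by (rule mod_int_unique(1)[of _ _ "q + 1"]) (use y t False in \<open>auto simp: algebra_simps\<close>)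
    then show ?thesis using False t by (simp add: half_sign_def t_def[symmetric])
  qed
qed

text \<open>Two half circles offset by \<open>d\<close> disagree exactly on two arcs of length
  \<open>d\<close>.\<close>

lemma half_sign_correlation_small:
  assumes "m > 0" "0 \<le> d" "d \<le> int m"
  shows "(\<Sum>x\<in>{0..<2 * int m}. half_sign m x * half_sign m (x + d)) = 2 * int m - 4 * d"
proof -
  define P where "P = (\<lambda>x. half_sign m x * half_sign m (x + d))"
  have first: "P x = (if x < int m - d then 1 else -1)" if "0 \<le> x" "x < int m" for x
    using that assms by (auto simp: P_def half_sign_def)
  \<comment> \<open>Both factors change sign at the antipode, so one half of the range
    suffices.\<close>
  have "P (x + int m) = P x" for x
    using half_sign_antipode[OF assms(1), of x] half_sign_antipode[OF assms(1), of "x + d"]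
    by (simp add: P_def algebra_simps)
  then have shift: "(\<Sum>x\<in>{int m..<2 * int m}. P x) = (\<Sum>x\<in>{0..<int m}. P x)"
    by (intro sum.reindex_bij_witness[of _ "\<lambda>x. x + int m" "\<lambda>x. x - int m"])
      (auto, metis diff_add_cancel)
  have "{0..<2 * int m} = {0..<int m} \<union> {int m..<2 * int m}" using assms by auto
  then have "(\<Sum>x\<in>{0..<2 * int m}. P x) = 2 * (\<Sum>x\<in>{0..<int m}. P x)"
    using shift by (simp add: sum.union_disjoint)
  also have "{0..<int m} = {0..<int m - d} \<union> {int m - d..<int m}" using assms by auto
  also have "(\<Sum>x\<in>{0..<int m - d} \<union> {int m - d..<int m}. P x) =
      (\<Sum>x\<in>{0..<int m - d}. P x) + (\<Sum>x\<in>{int m - d..<int m}. P x)"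
    by (rule sum.union_disjoint) auto
  also have "(\<Sum>x\<in>{0..<int m - d}. P x) = (\<Sum>x\<in>{0..<int m - d}. 1)"
    by (intro sum.cong) (use assms first in auto)
  also have "(\<Sum>x\<in>{int m - d..<int m}. P x) = (\<Sum>x\<in>{int m - d..<int m}. -1)"
    by (intro sum.cong) (use assms first in auto)
  finally show ?thesis using assms by (simp add: P_def)
qed

text \<open>This turns a distance between two points into a count of the half circles separating
  them, which can be summed over all pairs.\<close>

lemma half_sign_correlation:
  assumes "m > 0"
  shows "(\<Sum>x\<in>{0..<2 * int m}. half_sign m (x + p) * half_sign m (x + q)) =
    2 * int m - 4 * lee_abs (2 * m) (q - p)"
proof -
  define e where "e = (q - p) mod (2 * int m)"
  have e: "0 \<le> e" "e < 2 * int m" using assms by (simp_all add: e_def)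
  have "(\<Sum>x\<in>{0..<2 * int m}. half_sign m (x + p) * half_sign m (x + q)) =
      (\<Sum>x\<in>{0..<2 * int m}. half_sign m (p + x) * half_sign m (p + x + (q - p)))"
    by (simp add: algebra_simps)
  also have "\<dots> = (\<Sum>x\<in>{0..<2 * int m}. half_sign m x * half_sign m (x + (q - p)))"
  proof (rule sum_periodic_shift)
    fix x
    show "half_sign m (x + 2 * int m) * half_sign m (x + 2 * int m + (q - p)) =
        half_sign m x * half_sign m (x + (q - p))"
      using half_sign_periodic[of m x] half_sign_periodic[of m "x + (q - p)"]
      by (simp add: algebra_simps)
  qed (use assms in simp)
  also have "\<dots> = (\<Sum>x\<in>{0..<2 * int m}. half_sign m x * half_sign m (x + e))"
    by (simp add: half_sign_def e_def mod_simps)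
  also have "\<dots> = 2 * int m - 4 * min e (2 * int m - e)"
  proof (cases "e \<le> int m")
    case True
    then show ?thesis using half_sign_correlation_small[OF assms e(1) True] by simp
  next
    case False
    \<comment> \<open>An offset longer than a half circle is shortened by \<open>m\<close> at the
      price of a sign.\<close>
    have "half_sign m (x + e) = - half_sign m (x + (e - int m))" for x
      using half_sign_antipode[OF assms, of "x + (e - int m)"] by simp
    then have "(\<Sum>x\<in>{0..<2 * int m}. half_sign m x * half_sign m (x + e)) =
        - (\<Sum>x\<in>{0..<2 * int m}. half_sign m x * half_sign m (x + (e - int m)))"
      by (simp add: sum_negf)
    also have "\<dots> = - (2 * int m - 4 * (e - int m))"
      using half_sign_correlation_small[OF assms, of "e - int m"] False e by simp
    finally show ?thesis using False by simp
  qed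
  finally show ?thesis by (simp add: lee_abs_def e_def)
qed

text \<open>A half circle of \<open>\<int>/2m\<close> and its complement never contain equally many of the \<open>r\<close>
  points \<open>2 * f j\<close>; averaging over all half circles bounds the sum of all pairwise distances.\<close>

lemma upper_bound_odd_length:
  assumes "m > 0" "odd r" "\<And>x. N \<le> shift_norm m r f x"
  shows "4 * int r * N \<le> int m * ((int r)\<^sup>2 - 1)"
proof -
  define T where "T x = (\<Sum>j<r. half_sign m (x + 2 * f j))" for x
  \<comment> \<open>\<open>T x\<close> is the difference between the numbers of points in a half
    circle and in its complement; as a sum of an odd number of signs it cannot vanish.\<close>
  have "odd (T x)" for x
    unfolding T_def by (rule odd_sum_odd[OF assms(2)]) (simp add: half_sign_def)
  then have T: "1 \<le> (T x)\<^sup>2" for x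
    by (metis even_zero int_one_le_iff_zero_less zero_less_power2)
  have "2 * int m = (\<Sum>x\<in>{0..<2 * int m}. 1)" by simp
  also have "\<dots> \<le> (\<Sum>x\<in>{0..<2 * int m}. (T x)\<^sup>2)" by (intro sum_mono T)
  also have "\<dots> = (\<Sum>x\<in>{0..<2 * int m}. \<Sum>i<r. \<Sum>j<r.
      half_sign m (x + 2 * f i) * half_sign m (x + 2 * f j))"
    by (simp add: T_def power2_eq_square sum_product)
  also have "\<dots> = (\<Sum>i<r. \<Sum>x\<in>{0..<2 * int m}. \<Sum>j<r.
      half_sign m (x + 2 * f i) * half_sign m (x + 2 * f j))"
    by (rule sum.swap)
  also have "\<dots> = (\<Sum>i<r. \<Sum>j<r. \<Sum>x\<in>{0..<2 * int m}.
      half_sign m (x + 2 * f i) * half_sign m (x + 2 * f j))"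
    by (intro sum.cong refl sum.swap)
  also have "\<dots> = (\<Sum>i<r. \<Sum>j<r. 2 * int m - 8 * lee_abs m (f j + - f i))"
  proof (intro sum.cong refl)
    fix i j
    show "(\<Sum>x\<in>{0..<2 * int m}. half_sign m (x + 2 * f i) * half_sign m (x + 2 * f j)) =
        2 * int m - 8 * lee_abs m (f j + - f i)"
      using half_sign_correlation[OF assms(1), of "2 * f i" "2 * f j"]
        lee_abs_double[of m "f j - f i"] by (simp add: right_diff_distrib)
  qed
  \<comment> \<open>The distances from point \<open>i\<close> to all points add up to the norm at
    the shift \<open>- f i\<close>, so the bound \<open>N\<close> is used at these \<open>r\<close>
    shifts only.\<close>
  also have "\<dots> = (\<Sum>i<r. int r * (2 * int m) - 8 * shift_norm m r f (- f i))"
    by (simp add: sum_subtractf shift_norm_def sum_distrib_left)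
  also have "\<dots> \<le> (\<Sum>i<r. int r * (2 * int m) - 8 * N)"
    by (intro sum_mono diff_left_mono mult_left_mono assms(3)) auto
  also have "\<dots> = int r * (int r * (2 * int m) - 8 * N)" by simp
  finally show ?thesis by (simp add: power2_eq_square algebra_simps)
qed

section \<open>Constructions\<close>

lemma sum_lessThan_double:
  fixes g :: "nat \<Rightarrow> int"
  shows "(\<Sum>i<2 * k. g i) = (\<Sum>j<k. g (2 * j) + g (2 * j + 1))"
  by (induction k) (simp_all add: add.assoc)

text \<open>Points alternating between \<open>0\<close> and \<open>a\<close> form \<open>k\<close>
  antipodal pairs, so the norm is the same at every shift.\<close>

lemma attainable_even_even:
  assumes "a > 0"
  shows "attainable (2 * a) (2 * k) (int k * int a)"
proof (rule attainableI)
  fix x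
  have "lee_abs (2 * a) (int (2 * j) * int a + x) +
      lee_abs (2 * a) (int (2 * j + 1) * int a + x) = int a" for j
    using lee_abs_antipode[OF assms, of "int (2 * j) * int a + x"] by (simp add: algebra_simps)
  then show "int k * int a \<le> shift_norm (2 * a) (2 * k) (\<lambda>i. int i * int a) x"
    unfolding shift_norm_def sum_lessThan_double by simp
qed

text \<open>The points \<open>z\<close> for which the sum below is \<open>a + 1\<close> are those with \<open>z - 1\<close> in
  \<open>{0..<a}\<close> modulo \<open>2 * a + 1\<close>; writing this indicator with \<open>div\<close> makes it telescope.\<close>

lemma lee_abs_pair:
  "lee_abs (2 * a + 1) z + lee_abs (2 * a + 1) (z + int a) =
    int a + ((z - 1) div int (2 * a + 1) - (z - 1 - int a) div int (2 * a + 1))"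
proof -
  define M where "M = 2 * int a + 1"
  define t where "t = z mod M"
  define q where "q = z div M"
  have z: "z = M * q + t" and t: "0 \<le> t" "t < M"
    unfolding t_def q_def by (simp, simp add: M_def, rule pos_mod_bound, simp add: M_def)
  have M: "int (2 * a + 1) = M" by (simp add: M_def)
  \<comment> \<open>The sum is \<open>a + 1\<close> only in the middle case; \<open>t = 0\<close>
    stands apart because \<open>z - 1\<close> then falls into the previous block of length
    \<open>M\<close>.\<close>
  consider "t = 0" | "1 \<le> t" "t \<le> int a" | "int a + 1 \<le> t" using t by linarith
  then show ?thesis
  proof cases
    case 1
    have "(z - 1) div M = q - 1"
      by (rule mod_int_unique(2)[of _ _ _ "M - 1"]) (use z t 1 in \<open>auto simp: M_def algebra_simps\<close>)
    moreover have "(z - 1 - int a) div M = q - 1"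
      by (rule mod_int_unique(2)[of _ _ _ "int a"]) (use z t 1 in \<open>auto simp: M_def algebra_simps\<close>)
    moreover have "(z + int a) mod M = int a"
      by (rule mod_int_unique(1)[of _ _ q]) (use z t 1 in \<open>auto simp: M_def\<close>)
    ultimately show ?thesis using 1 unfolding lee_abs_def M t_def[symmetric] by (simp add: M_def)
  next
    case 2
    have "(z - 1) div M = q"
      by (rule mod_int_unique(2)[of _ _ _ "t - 1"]) (use z t 2 in \<open>auto simp: M_def algebra_simps\<close>)
    moreover have "(z - 1 - int a) div M = q - 1"
      by (rule mod_int_unique(2)[of _ _ _ "t + int a"]) (use z t 2 in \<open>auto simp: M_def algebra_simps\<close>)
    moreover have "(z + int a) mod M = t + int a"
      by (rule mod_int_unique(1)[of _ _ q]) (use z t 2 in \<open>auto simp: M_def\<close>)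
    ultimately show ?thesis using 2 unfolding lee_abs_def M t_def[symmetric] by (simp add: M_def)
  next
    case 3
    have "(z - 1) div M = q"
      by (rule mod_int_unique(2)[of _ _ _ "t - 1"]) (use z t 3 in \<open>auto simp: M_def algebra_simps\<close>)
    moreover have "(z - 1 - int a) div M = q"
      by (rule mod_int_unique(2)[of _ _ _ "t - 1 - int a"]) (use z t 3 in \<open>auto simp: M_def algebra_simps\<close>)
    moreover have "(z + int a) mod M = t + int a - M"
      by (rule mod_int_unique(1)[of _ _ "q + 1"]) (use z t 3 in \<open>auto simp: M_def algebra_simps\<close>)
    ultimately show ?thesis using 3 t unfolding lee_abs_def M t_def[symmetric] by (simp add: M_def)
  qed
qed

text \<open>The points are \<open>0, a, a, 2a, 2a, ...\<close>, so pair \<open>j\<close> spans the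
  arc from \<open>j * a\<close> to \<open>(j + 1) * a\<close>. The excesses over \<open>a\<close>
  from \<open>lee_abs_pair\<close> telescope to the number of multiples of \<open>M\<close> passed
  while advancing by \<open>k * a\<close>.\<close>

lemma shift_norm_odd_even:
  "int k * int a + (int k * int a) div int (2 * a + 1)
     \<le> shift_norm (2 * a + 1) (2 * k) (\<lambda>i. int ((i + 1) div 2) * int a) x"
proof -
  define M where "M = int (2 * a + 1)"
  define D where "D j = (x - 1 - int a + int j * int a) div M" for j
  have "shift_norm (2 * a + 1) (2 * k) (\<lambda>i. int ((i + 1) div 2) * int a) x =
      (\<Sum>j<k. lee_abs (2 * a + 1) (int j * int a + x) +
        lee_abs (2 * a + 1) ((int j * int a + x) + int a))"
    unfolding shift_norm_def sum_lessThan_double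
  proof (intro sum.cong refl)
    fix j
    have *: "int ((2 * j + 1) div 2) * int a + x = int j * int a + x"
      "int ((2 * j + 1 + 1) div 2) * int a + x = int j * int a + x + int a"
      by (simp_all add: algebra_simps)
    show "lee_abs (2 * a + 1) (int ((2 * j + 1) div 2) * int a + x) +
        lee_abs (2 * a + 1) (int ((2 * j + 1 + 1) div 2) * int a + x) =
        lee_abs (2 * a + 1) (int j * int a + x) + lee_abs (2 * a + 1) (int j * int a + x + int a)"
      unfolding * ..
  qed
  also have "\<dots> = (\<Sum>j<k. int a + (D (Suc j) - D j))"
  proof (intro sum.cong refl)
    fix j
    have "int j * int a + x - 1 = x - 1 - int a + int (Suc j) * int a"
      "int j * int a + x - 1 - int a = x - 1 - int a + int j * int a"
      by (simp_all add: algebra_simps)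
    then show "lee_abs (2 * a + 1) (int j * int a + x) +
        lee_abs (2 * a + 1) ((int j * int a + x) + int a) = int a + (D (Suc j) - D j)"
      unfolding lee_abs_pair D_def M_def by presburger
  qed
  also have "\<dots> = int k * int a + (D k - D 0)"
    by (simp add: sum.distrib sum_lessThan_telescope)
  finally have eq: "shift_norm (2 * a + 1) (2 * k) (\<lambda>i. int ((i + 1) div 2) * int a) x =
    int k * int a + (D k - D 0)" .
  \<comment> \<open>The carry in \<open>div_add1_eq\<close> is nonnegative, which makes
    \<open>div\<close> superadditive whatever the starting point.\<close>
  have "0 \<le> ((x - 1 - int a) mod M + (int k * int a) mod M) div M"
    by (intro pos_imp_zdiv_nonneg_iff[THEN iffD2]) (auto simp: M_def)
  then have "D 0 + (int k * int a) div M \<le> D k"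
    unfolding D_def using div_add1_eq[of "x - 1 - int a" "int k * int a" M] by simp
  then show ?thesis unfolding eq M_def by simp
qed

lemma attainable_odd_even:
  "attainable (2 * a + 1) (2 * k) (int k * int a + (int k * int a) div int (2 * a + 1))"
  by (rule attainableI[OF shift_norm_odd_even])

section \<open>Odd modulus: adding a full circle\<close>

lemma sum_lessThan_add:
  fixes g :: "nat \<Rightarrow> int"
  shows "(\<Sum>i<m + n. g i) = (\<Sum>i<m. g i) + (\<Sum>i<n. g (m + i))"
  by (induction n) simp_all

lemma shift_norm_full_circle:
  "shift_norm (2 * a + 1) (2 * a + 1) int x = int a * (int a + 1)"
proof -
  have "shift_norm (2 * a + 1) (2 * a + 1) int x =
      (\<Sum>y\<in>{0..<int (2 * a + 1)}. lee_abs (2 * a + 1) (x + y))"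
    unfolding shift_norm_def
    by (rule sum.reindex_bij_witness[of _ nat int]) (auto simp: add.commute)
  also have "\<dots> = (\<Sum>y\<in>{0..<int (2 * a + 1)}. lee_abs (2 * a + 1) y)"
    by (rule sum_periodic_shift) (auto simp: lee_abs_def)
  finally show ?thesis by (simp only: sum_lee_abs_odd)
qed

text \<open>One point in every residue class has the same norm at all shifts, so it raises every
  lower bound by that constant.\<close>

lemma attainable_add_full_circle:
  assumes "attainable (2 * a + 1) r B"
  shows "attainable (2 * a + 1) (2 * a + 1 + r) (int a * (int a + 1) + B)"
proof -
  obtain f where f: "\<And>x. B \<le> shift_norm (2 * a + 1) r f x"
    using assms unfolding attainable_def by blast
  define g where "g i = (if i < 2 * a + 1 then int i else f (i - (2 * a + 1)))" for i
  have "shift_norm (2 * a + 1) (2 * a + 1 + r) g x =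
      shift_norm (2 * a + 1) (2 * a + 1) int x + shift_norm (2 * a + 1) r f x" for x
    unfolding shift_norm_def sum_lessThan_add
    by (intro arg_cong2[of _ _ _ _ "(+)"] sum.cong) (auto simp: g_def)
  then show ?thesis
    using f by (intro attainableI[of _ _ _ g]) (simp only: shift_norm_full_circle add_left_mono)
qed

text \<open>The inequality says that \<open>B + 1\<close> already breaks
  \<open>upper_bound_odd_modulus\<close>, so the two together leave a single integer for the
  maximum.\<close>

lemma attainable_odd_modulus:
  assumes "odd m" "even r \<or> m < r"
  obtains B where "attainable m r B" "int r * ((int m)\<^sup>2 - 1) < 4 * int m * (B + 1)"
proof -
  obtain a where m: "m = 2 * a + 1" using assms(1) by (auto elim: oddE)
  have *: "2 * int k * ((int m)\<^sup>2 - 1) <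
    4 * int m * (int k * int a + (int k * int a) div int m + 1)" for k
  proof -
    have "int k * int a < int m * ((int k * int a) div int m + 1)"
      using mult_div_mod_eq[of "int m" "int k * int a"]
        pos_mod_bound[of "int m" "int k * int a"] odd_pos[OF assms(1)]
      unfolding distrib_left by linarith
    moreover have "2 * int k * ((int m)\<^sup>2 - 1) = 4 * (int m * (int k * int a) + int k * int a)"
      by (simp add: m power2_eq_square algebra_simps)
    ultimately show ?thesis by (simp add: algebra_simps)
  qed
  show thesis
  proof (cases "even r")
    case True
    then obtain k where "r = 2 * k" by (auto elim: evenE)
    then show ?thesis using that attainable_odd_even[of a k] *[of k] by (simp add: m)
  next
    case False
    \<comment> \<open>Both numbers are odd, so removing one full circle leaves an even number of
      points.\<close>
    then have "even (r - m)" using assms by auto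
    then obtain k where "r - m = 2 * k" by blast
    then have r: "r = m + 2 * k" using False assms(2) by simp
    have att: "attainable m r (int a * (int a + 1) + (int k * int a + (int k * int a) div int m))"
      using attainable_add_full_circle[OF attainable_odd_even[of a k]] by (simp only: m r)
    have "int m * ((int m)\<^sup>2 - 1) = 4 * int m * (int a * (int a + 1))"
      by (simp add: m power2_eq_square algebra_simps)
    then have "int r * ((int m)\<^sup>2 - 1) <
        4 * int m * ((int a * (int a + 1) + (int k * int a + (int k * int a) div int m)) + 1)"
      using *[of k] by (simp add: r algebra_simps)
    then show ?thesis using that att by blast
  qed
qed

section \<open>Odd length: alternating antipodes on a half circle\<close>

lemma alternating_abs_sum_ge:
  fixes z b :: "nat \<Rightarrow> int"
  assumes "\<And>j. j < n \<Longrightarrow> b j \<le> z (2 * j + 1) - z (2 * j)"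
    and "\<And>j. j < n \<Longrightarrow> b j \<le> z (2 * j + 2) - z (2 * j + 1)"
    and "mono z"
  shows "(\<Sum>j<n. b j) \<le> (\<Sum>l<2 * n + 1. (-1) ^ l * \<bar>z l - y\<bar>)"
  using assms(1,2)
proof (induction n)
  case 0
  then show ?case by simp
next
  case (Suc n)
  have split: "(\<Sum>l<2 * Suc n + 1. (-1) ^ l * \<bar>z l - y\<bar>) =
      (\<Sum>l<2 * n + 1. (-1) ^ l * \<bar>z l - y\<bar>) - \<bar>z (2 * n + 1) - y\<bar> + \<bar>z (2 * n + 2) - y\<bar>"
    by simp
  \<comment> \<open>If \<open>y\<close> is at most \<open>z (2 * n + 1)\<close>, the last two terms
    contribute a full gap and induction handles the rest. Otherwise all points but the last lie left
    of \<open>y\<close>; paired from the front they contribute gaps, and the last term is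
    nonnegative. So each \<open>b j\<close> has to bound the gaps on both sides of
    \<open>z (2 * j + 1)\<close>.\<close>
  show ?case
  proof (cases "y \<le> z (2 * n + 1)")
    case True
    moreover have "z (2 * n + 1) \<le> z (2 * n + 2)" by (rule monoD[OF assms(3)]) simp
    ultimately have "- \<bar>z (2 * n + 1) - y\<bar> + \<bar>z (2 * n + 2) - y\<bar> \<ge> b n"
      using Suc.prems(2)[of n] by simp
    moreover have "(\<Sum>j<n. b j) \<le> (\<Sum>l<2 * n + 1. (-1) ^ l * \<bar>z l - y\<bar>)"
      by (rule Suc.IH) (use Suc.prems in auto)
    ultimately show ?thesis unfolding split by simp
  next
    case False
    have "\<bar>z l - y\<bar> = y - z l" if "l < 2 * n + 2" for l
      using monoD[OF assms(3), of l "2 * n + 1"] that False by simp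
    then have "(\<Sum>l<2 * Suc n. (-1) ^ l * \<bar>z l - y\<bar>) = (\<Sum>l<2 * Suc n. (-1) ^ l * (y - z l))"
      by (intro sum.cong) auto
    also have "\<dots> = (\<Sum>j<Suc n. z (2 * j + 1) - z (2 * j))"
      unfolding sum_lessThan_double by (intro sum.cong) auto
    also have "\<dots> \<ge> (\<Sum>j<Suc n. b j)" by (intro sum_mono Suc.prems) auto
    finally have "(\<Sum>j<Suc n. b j) \<le> (\<Sum>l<2 * Suc n. (-1) ^ l * \<bar>z l - y\<bar>)" .
    then show ?thesis by simp
  qed
qed

text \<open>In \<open>\<int>/2m\<close> the doubled points \<open>2 * (l * c + min l s)\<close> are \<open>z l + l * m\<close> with
  \<open>z\<close> nearly equidistributed on a half circle: every other one is replaced by its antipode, so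
  that twice the norm is an alternating sum of distances to \<open>z l\<close>.\<close>

lemma attainable_odd_length_explicit:
  assumes "m > 0" "m = Q * (2 * n + 1) + 2 * s" "s \<le> 2 * n"
  shows "attainable m (2 * n + 1) (int (Q * n * (n + 1) + n * s + (s - 1) div 2))"
    (is "attainable m _ ?B")
proof (rule attainableI)
  fix x
  \<comment> \<open>Chosen so that \<open>2 * c = m + Q\<close>: in doubled coordinates each step is
    an antipode plus a gap of about \<open>Q\<close>.\<close>
  define c where "c = Q * (n + 1) + s"
  define V where "V l = int (l * c + min l s)" for l
  define z where "z l = int (l * Q + 2 * min l s)" for l
  \<comment> \<open>The first \<open>s\<close> gaps of \<open>z\<close> are \<open>Q + 2\<close>,
    the others \<open>Q\<close>. \<open>lower\<close> needs the gaps numbered \<open>2 * j\<close>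
    and \<open>2 * j + 1\<close>, \<open>upper\<close> those numbered \<open>2 * j + 1\<close> and
    \<open>2 * j + 2\<close>; all three are long exactly when
    \<open>j < (s - 1) div 2\<close>.\<close>
  define b where "b j = int Q + 2 * (if j < (s - 1) div 2 then 1 else 0)" for j :: nat
  define A where "A y = (\<Sum>l<2 * n + 1. (-1) ^ l * \<bar>z l - y\<bar>)" for y
  have V: "2 * V l = z l + int l * int m" for l
    by (simp add: V_def z_def c_def assms(2) algebra_simps)
  have mono: "mono z"
    unfolding z_def
    by (intro monoI of_nat_mono add_mono mult_right_mono mult_left_mono min.mono) auto
  have z_last: "z (2 * n + 1) = int m" using assms(3) by (simp add: z_def assms(2) algebra_simps)
  have b_gap: "b j \<le> z (l + 1) - z l" if "l \<le> 2 * j + 2" for j l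
    using that by (auto simp: b_def z_def min_def algebra_simps)
  have "(\<Sum>j<n. if j < k then 1 else 0) = int (min n k)" for k
    by (induction n) auto
  moreover have "min n ((s - 1) div 2) = (s - 1) div 2" using assms(3) by auto
  ultimately have "(\<Sum>j<n. b j) = int n * int Q + 2 * int ((s - 1) div 2)"
    by (simp add: b_def sum.distrib sum_distrib_left[symmetric])
  then have b_sum: "2 * ?B = int n * int m + (\<Sum>j<n. b j)"
    by (simp add: assms(2) algebra_simps)
  have lower: "(\<Sum>j<n. b j) \<le> A y" for y
    unfolding A_def
    by (rule alternating_abs_sum_ge)
      (use b_gap[of "2 * j" j for j] b_gap[of "2 * j + 1" j for j] mono in auto)
  \<comment> \<open>Dropping \<open>z 0 = 0\<close> and appending \<open>z (2 * n + 1) = m\<close>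
    reverses the signs, while the distances from \<open>y\<close> to these two ends add up to
    \<open>m\<close>.\<close>
  have upper: "(\<Sum>j<n. b j) \<le> int m - A y" if "0 \<le> y" "y \<le> int m" for y
  proof -
    have "(\<Sum>j<n. b j) \<le> (\<Sum>l<2 * n + 1. (-1) ^ l * \<bar>z (Suc l) - y\<bar>)"
    proof (rule alternating_abs_sum_ge)
      show "b j \<le> z (Suc (2 * j + 1)) - z (Suc (2 * j))"
        "b j \<le> z (Suc (2 * j + 2)) - z (Suc (2 * j + 1))" for j
        using b_gap[of "2 * j + 1" j] b_gap[of "2 * j + 2" j] by simp_all
      show "mono (\<lambda>l. z (Suc l))" using mono by (simp add: mono_def)
    qed
    also have "\<dots> = \<bar>z 0 - y\<bar> - (\<Sum>l<Suc (2 * n + 1). (-1) ^ l * \<bar>z l - y\<bar>)"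
      unfolding sum.lessThan_Suc_shift by (simp add: sum_negf)
    also have "\<dots> = int m - A y"
    proof -
      have "\<bar>z 0 - y\<bar> = y" "\<bar>z (2 * n + 1) - y\<bar> = int m - y"
        using that unfolding z_last by (simp_all add: z_def)
      then show ?thesis unfolding sum.lessThan_Suc[of _ "2 * n + 1"] A_def[symmetric] by simp
    qed
    finally show ?thesis .
  qed
  define L where "L = lee_abs (2 * m)"
  define K where "K l = (if even l then 0 else int m)" for l :: nat
  have L_antipode: "L (w + int m) = int m - L w" for w
    using lee_abs_antipode[OF assms(1)] by (simp add: L_def)
  \<comment> \<open>Each further \<open>m\<close> replaces the distance by \<open>m\<close> minus
    it, so odd \<open>l\<close> yields a minus sign and a constant \<open>m\<close>.\<close>
  have L_mult: "L (w + int l * int m) = (-1) ^ l * L w + K l" for w l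
  proof (induction l)
    case (Suc l)
    have "L (w + int (Suc l) * int m) = int m - L (w + int l * int m)"
      using L_antipode[of "w + int l * int m"] by (simp add: algebra_simps)
    then show ?case using Suc by (simp add: K_def)
  qed (simp add: K_def)
  have L_abs: "L (z l - y) = \<bar>z l - y\<bar>" if "l < 2 * n + 1" "0 \<le> y" "y \<le> int m" for l y
  proof -
    have "0 \<le> z l" by (simp add: z_def)
    moreover have "z l \<le> int m" using monoD[OF mono, of l "2 * n + 1"] that(1) z_last by simp
    ultimately show ?thesis
      unfolding L_def using that assms(1) by (intro lee_abs_of_abs_le) auto
  qed
  have K_sum: "(\<Sum>l<2 * n + 1. K l) = int n * int m"
    by (induction n) (simp_all add: K_def algebra_simps)
  \<comment> \<open>Shifting the doubled points by \<open>2 * x\<close> amounts to measuring their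
    distances from \<open>y\<close>.\<close>
  define y where "y = (- 2 * x) mod (2 * int m)"
  have y: "0 \<le> y" "y < 2 * int m" using assms(1) by (simp_all add: y_def)
  have "2 * lee_abs m (V l + x) = L (z l - y + int l * int m)" for l
  proof -
    have "2 * lee_abs m (V l + x) = L (2 * V l + 2 * x)"
      using lee_abs_double[of m "V l + x"] by (simp add: L_def)
    also have "\<dots> = L (2 * V l - y)"
      unfolding L_def y_def by (rule lee_abs_cong) (simp add: mod_simps)
    finally show ?thesis unfolding V by (simp add: algebra_simps)
  qed
  then have S: "2 * shift_norm m (2 * n + 1) V x =
      (\<Sum>l<2 * n + 1. L (z l - y + int l * int m))"
    by (simp add: shift_norm_def sum_distrib_left)
  have "2 * ?B \<le> 2 * shift_norm m (2 * n + 1) V x"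
  proof (cases "y \<le> int m")
    case True
    have "2 * shift_norm m (2 * n + 1) V x = (\<Sum>l<2 * n + 1. (-1) ^ l * \<bar>z l - y\<bar> + K l)"
      unfolding S L_mult using L_abs y True by (intro sum.cong) auto
    also have "\<dots> = A y + int n * int m" by (simp only: sum.distrib K_sum A_def)
    finally show ?thesis using lower[of y] b_sum by linarith
  next
    case False
    \<comment> \<open>Beyond the half circle the antipode of \<open>y\<close> serves instead; every
      distance is complemented, so \<open>upper\<close> replaces \<open>lower\<close>.\<close>
    define y' where "y' = y - int m"
    have y': "0 \<le> y'" "y' \<le> int m" using False y by (auto simp: y'_def)
    have "L (z l - y + int l * int m) = int m - L (z l - y' + int l * int m)" for l
      using L_antipode[of "z l - y + int l * int m"] by (simp add: y'_def algebra_simps)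
    then have "2 * shift_norm m (2 * n + 1) V x =
        (\<Sum>l<2 * n + 1. int m - ((-1) ^ l * \<bar>z l - y'\<bar> + K l))"
      unfolding S using L_abs y' by (intro sum.cong) (auto simp: L_mult)
    also have "\<dots> = int (2 * n + 1) * int m - (A y' + int n * int m)"
      by (simp only: sum_subtractf sum.distrib K_sum A_def sum_constant card_lessThan)
    also have "\<dots> = int n * int m + (int m - A y')" by (simp add: algebra_simps)
    finally show ?thesis using upper[OF y'] b_sum by linarith
  qed
  then show "?B \<le> shift_norm m (2 * n + 1) V x" by simp
qed

text \<open>As for odd modulus, \<open>B + 1\<close> breaks the matching upper bound, here
  \<open>upper_bound_odd_length\<close>.\<close>

lemma attainable_odd_length:
  assumes "m > 0" "odd r" "even m \<or> r \<le> m"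
  obtains B where "attainable m r B" "int m * ((int r)\<^sup>2 - 1) < 4 * int r * (B + 1)"
proof -
  obtain n where r: "r = 2 * n + 1" using assms(2) by (auto elim: oddE)
  \<comment> \<open>As \<open>r\<close> is odd, \<open>Q\<close> must have the parity of
    \<open>m\<close>; for odd \<open>m\<close> this forces \<open>Q\<close> to be at least 1, hence
    \<open>r \<le> m\<close>.\<close>
  obtain Q s where m: "m = Q * r + 2 * s" and s: "s < r"
  proof (cases "even m")
    case True
    then obtain k where k: "m = 2 * k" by (auto elim: evenE)
    have "m = (2 * (k div r)) * r + 2 * (k mod r)"
      using arg_cong[OF div_mult_mod_eq[of k r], of "(*) 2"]
      unfolding k by (simp only: algebra_simps)
    then show thesis using that[of "2 * (k div r)" "k mod r"] r by simp
  next
    case False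
    then have "even (m - r)" using assms by auto
    then obtain k where "m - r = 2 * k" by blast
    then have k: "m = r + 2 * k" using False assms(3) by simp
    have "m = (2 * (k div r) + 1) * r + 2 * (k mod r)"
      using arg_cong[OF div_mult_mod_eq[of k r], of "(*) 2"]
      unfolding k by (simp only: algebra_simps)
    then show thesis using that[of "2 * (k div r) + 1" "k mod r"] r by simp
  qed
  define e where "e = (s - 1) div 2"
  have att: "attainable m r (int (Q * n * (n + 1) + n * s + e))"
    unfolding r e_def
    by (rule attainable_odd_length_explicit[OF assms(1)]) (use m s r in auto)
  \<comment> \<open>Expanding \<open>m * (r^2 - 1)\<close> leaves only
    \<open>n * s < r * (e + 1)\<close> to be shown, so the rounding in \<open>e\<close> is
    harmless.\<close>
  have "s \<le> 2 * e + 2" by (auto simp: e_def)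
  then have "n * s \<le> n * (2 * e + 2)" by (rule mult_left_mono) simp
  then have "n * s < r * (e + 1)" by (simp add: r algebra_simps)
  then have "int n * int s < int r * (int e + 1)"
    by (metis of_nat_1 of_nat_add of_nat_less_iff of_nat_mult)
  moreover have "int m * ((int r)\<^sup>2 - 1) =
      4 * (int r * (int Q * int n * (int n + 1) + int n * int s) + int n * int s)"
    by (simp add: m r power2_eq_square algebra_simps)
  ultimately have "int m * ((int r)\<^sup>2 - 1) < 4 * int r * (int (Q * n * (n + 1) + n * s + e) + 1)"
    by (simp add: algebra_simps)
  then show thesis using that att by blast
qed

section \<open>The maximum\<close>

lemma floor_mult_quarter_minus:
  fixes N :: int
  assumes "q > 0" "4 * int q * N \<le> int p * ((int q)\<^sup>2 - 1)"
    "int p * ((int q)\<^sup>2 - 1) < 4 * int q * (N + 1)"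
  shows "\<lfloor>real p * real q / 4 - real p / (4 * real q)\<rfloor> = N"
proof (rule floor_unique)
  have "real_of_int (4 * int q * N) \<le> real_of_int (int p * ((int q)\<^sup>2 - 1))"
    "real_of_int (int p * ((int q)\<^sup>2 - 1)) < real_of_int (4 * int q * (N + 1))"
    using assms(2,3) by (simp_all only: of_int_le_iff of_int_less_iff)
  then show "real_of_int N \<le> real p * real q / 4 - real p / (4 * real q)"
    "real p * real q / 4 - real p / (4 * real q) < real_of_int N + 1"
    using assms(1) by (simp_all add: field_simps power2_eq_square)
qed

lemma floor_mult_quarter_minus_half:
  fixes N :: int
  assumes "4 * N \<le> int p * int q - 2" "int p * int q - 2 < 4 * N + 4"
  shows "\<lfloor>real p * real q / 4 - 1 / 2\<rfloor> = N"
proof (rule floor_unique)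
  have "real_of_int (4 * N) \<le> real_of_int (int p * int q - 2)"
    "real_of_int (int p * int q - 2) < real_of_int (4 * N + 4)"
    using assms by (simp_all only: of_int_le_iff of_int_less_iff)
  then show "real_of_int N \<le> real p * real q / 4 - 1 / 2"
    "real p * real q / 4 - 1 / 2 < real_of_int N + 1"
    by simp_all
qed

text \<open>For \<open>p < q\<close> the correction \<open>p / q\<close> is below 1, so integrality
  absorbs it; this gives the lower half of the formulas with \<open>1 / 2\<close>.\<close>

lemma mult_le_of_less:
  fixes N :: int
  assumes "0 < p" "p < q" "int p * ((int q)\<^sup>2 - 1) < 4 * int q * (N + 1)"
  shows "int p * int q \<le> 4 * N + 4"
proof -
  have "int q * (int p * int q - 1) < int q * (4 * N + 4)"
    using assms(2,3) by (simp add: power2_eq_square algebra_simps)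
  then show ?thesis using assms(2) by (simp add: mult_less_cancel_left)
qed

theorem theorem2p6:
  fixes m r :: nat and v :: "nat \<Rightarrow> int"
  assumes "m > 0" and "r > 0"
    and "admissible m r v"
    and "\<And>w. admissible m r w \<Longrightarrow> lee_norm m r w \<le> lee_norm m r v"
  shows "real_of_int (lee_norm m r v) = h m r"
proof -
  define N where "N = lee_norm m r v"
  define f where "f = (\<lambda>j. v (Suc j))"
  have up: "N \<le> shift_norm m r f x" for x
    unfolding N_def f_def by (rule admissible_le_shift_norm[OF assms(1,3)])
  have lo: "B \<le> N" if att: "attainable m r B" for B
  proof -
    obtain w where "admissible m r w" "B \<le> lee_norm m r w"
      by (rule attainable_imp_admissible[OF assms(1) att])
    then show ?thesis using assms(4)[of w] by (simp add: N_def)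
  qed
  have lo_m: "int r * ((int m)\<^sup>2 - 1) < 4 * int m * (N + 1)" if odd: "odd m" "even r \<or> m < r"
  proof -
    obtain B where B: "attainable m r B" "int r * ((int m)\<^sup>2 - 1) < 4 * int m * (B + 1)"
      using attainable_odd_modulus[OF odd] .
    have "4 * int m * (B + 1) \<le> 4 * int m * (N + 1)"
      using lo[OF B(1)] by (intro mult_left_mono) auto
    with B(2) show ?thesis by linarith
  qed
  have lo_r: "int m * ((int r)\<^sup>2 - 1) < 4 * int r * (N + 1)" if odd: "odd r" "even m \<or> r \<le> m"
  proof -
    obtain B where B: "attainable m r B" "int m * ((int r)\<^sup>2 - 1) < 4 * int r * (B + 1)"
      using attainable_odd_length[OF assms(1) odd] .
    have "4 * int r * (B + 1) \<le> 4 * int r * (N + 1)"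
      using lo[OF B(1)] by (intro mult_left_mono) auto
    with B(2) show ?thesis by linarith
  qed
  consider (1) "even m" "even r" | (2) "even m" "odd r" "r > m" | (3) "odd m" "r > m"
    | (4) "odd m" "even r" "r < m" | (5) "odd r" "r \<le> m"
    by (metis linorder_not_less nat_less_le)
  then have "real_of_int N = h m r"
  proof cases
    case 1
    then obtain a k where mr: "m = 2 * a" "r = 2 * k" by (auto elim!: evenE)
    have a: "a > 0" using assms(1) mr by simp
    have "int k * int a \<le> N" using lo attainable_even_even[OF a, of k] by (simp add: mr)
    moreover have "2 * N \<le> int r * int a"
      using upper_bound_even_modulus[OF a, of N r f] up by (simp add: mr(1))
    ultimately have "N = int k * int a" by (simp add: mr(2))
    then show ?thesis by (simp add: h_def mr)
  next
    case 2
    then obtain a where m: "m = 2 * a" by (auto elim: evenE)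
    have a: "a > 0" using assms(1) m by simp
    have "2 * N \<le> int r * int a - 1"
      using upper_bound_even_modulus_odd_length[OF a 2(2), of N f] up by (simp add: m)
    then have "4 * N \<le> int m * int r - 2" by (simp add: m algebra_simps)
    \<comment> \<open>The odd-length construction is available for \<open>r > m\<close> because
      \<open>m\<close> is even.\<close>
    moreover have "int m * int r \<le> 4 * N + 4"
      using mult_le_of_less[OF assms(1) 2(3)] lo_r 2 by simp
    ultimately have "\<lfloor>real m * real r / 4 - 1 / 2\<rfloor> = N"
      by (intro floor_mult_quarter_minus_half) auto
    then show ?thesis using 2 by (simp add: h_def)
  next
    case 3
    have "\<lfloor>real r * real m / 4 - real r / (4 * real m)\<rfloor> = N"
      by (intro floor_mult_quarter_minus assms(1) upper_bound_odd_modulus[OF 3(1) up] lo_m)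
        (use 3 in auto)
    then show ?thesis using 3 by (simp add: h_def mult.commute)
  next
    case 4
    have "4 * int m * N \<le> int r * ((int m)\<^sup>2 - 1)" by (rule upper_bound_odd_modulus[OF 4(1) up])
    also have "\<dots> < int m * (int r * int m)"
      using assms(2) by (simp add: power2_eq_square algebra_simps)
    finally have "int m * (4 * N) < int m * (int r * int m)" by (simp add: algebra_simps)
    then have "4 * N < int r * int m" using assms(1) by (simp add: mult_less_cancel_left)
    \<comment> \<open>With \<open>r\<close> even the strict inequality can be halved before
      rounding, which gains 2 instead of 1.\<close>
    moreover obtain k where k: "r = 2 * k" using 4(2) by (auto elim: evenE)
    ultimately have "2 * N < int k * int m" by simp
    then have "4 * N \<le> int r * int m - 2" by (simp add: k)
    moreover have "int r * int m \<le> 4 * N + 4"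
      using mult_le_of_less[OF assms(2) 4(3)] lo_m 4 by simp
    ultimately have "\<lfloor>real m * real r / 4 - 1 / 2\<rfloor> = N"
      by (intro floor_mult_quarter_minus_half) (auto simp: mult.commute)
    then show ?thesis using 4 by (simp add: h_def)
  next
    case 5
    have "\<lfloor>real m * real r / 4 - real m / (4 * real r)\<rfloor> = N"
      by (intro floor_mult_quarter_minus assms(2) upper_bound_odd_length[OF assms(1) 5(1) up] lo_r)
        (use 5 in auto)
    then show ?thesis using 5 by (simp add: h_def)
  qed
  then show ?thesis by (simp add: N_def)
qed

end
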